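(* Consider the physical-layer-security coalition formation game with finite user set $\mathcal{N}=\{1,\dots,N\}$ and payoffs $\phi_i(S)\in\mathbb{R}\cup\{-\infty\}$ ($\emptyset\neq S\subseteq\mathcal{N}$, $i\in S$) defined in the context, together with the Pareto order $\triangleright$ and the merge-and-split coalition formation algorithm. Then the algorithm converges (terminates at a final partition). If a $\mathbb{D}_c$-stable partition of $\mathcal{N}$ exists, the final partition is the $\mathbb{D}_c$-stable partition $\mathcal{T}$, which is optimal in the sense that $\mathcal{T}\triangleright\mathcal{T}'$ for every partition $\mathcal{T}'\neq\mathcal{T}$ of $\mathcal{N}$. Otherwise, the final partition is $\mathbb{D}_{hp}$-stable.
   Context: **Model.** There are $N$ users $\mathcal{N}=\{1,\dots,N\}$, destinations $\mathcal{M}=\{1,\dots,M\}$, and eavesdroppers $\mathcal{K}=\{1,\dots,K\}$ with $K>1$, located at distinct points. Each user $i$ has an assigned destination $m_i\in\mathcal{M}$. Fix the path-loss exponent $\mu>0$, noise variance $\sigma^2>0$, power per slot $\tilde P>0$, and target signal-to-noise ratio $\nu_0>0$. The channel gains are $h_{i,m_i}=d_{i,m_i}^{-\mu/2}e^{\mathrm{j}\phi_{i,m_i}}\in\mathbb{C}$ (user $i$ to its destination) and $g_{i,k}=d_{i,k}^{-\mu/2}e^{\mathrm{j}\phi_{i,k}}\in\mathbb{C}$ (user $i$ to eavesdropper $k$). Here $d$ denotes distance, the real numbers $\phi_{i,m_i},\phi_{i,k}$ are phase offsets, and $\mathrm{j}$ is the imaginary unit. Write $a^+=\max(a,0)$.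 **Payoffs.** A coalition is a nonempty $S\subseteq\mathcal{N}$. For a singleton, the payoff is the non-cooperative secrecy capacity $$\phi_i(\{i\})=\Bigl(\log_2\bigl(1+\tfrac{\tilde P|h_{i,m_i}|^2}{\sigma^2}\bigr)-\max_{1\le k\le K}\log_2\bigl(1+\tfrac{\tilde P|g_{i,k}|^2}{\sigma^2}\bigr)\Bigr)^+.$$ For $|S|\ge2$ and $i\in S$, let $\hat i\in S$ be a member of $S$ farthest from $i$. Let $\bar P_{i,\hat i}=\nu_0\sigma^2 d_{i,\hat i}^{\mu}$ and $P_i^S=(\tilde P-\bar P_{i,\hat i})^+$. With $S=\{i_1,\dots,i_{|S|}\}$, set - $\boldsymbol h_S=[h_{i_1,m_{i_1}},\dots,h_{i_{|S|},m_{i_{|S|}}}]^H$ and $\boldsymbol g_S^k=[g_{i_1,k},\dots,g_{i_{|S|},k}]^H$ (column vectors), - $\boldsymbol G_S=[\boldsymbol h_S,\boldsymbol g_S^1,\dots,\boldsymbol g_S^K]^H$, a $(K+1)\times|S|$ matrix, - $\boldsymbol e=[1,0,\dots,0]^H\in\mathbb{C}^{K+1}$, - $\beta_i^S=\sqrt{P_i^S/(\boldsymbol e^H(\boldsymbol G_S\boldsymbol G_S^H)^{-1}\boldsymbol e)}$ and $\boldsymbol w_S^{opt}=\beta_i^S\boldsymbol G_S^H(\boldsymbol G_S\boldsymbol G_S^H)^{-1}\boldsymbol e$. The gain is $v_i(S)=\frac12\log_2\bigl(1+\frac{(\boldsymbol w_S^{opt})^H\boldsymbol h_S\boldsymbol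 h_S^H\boldsymbol w_S^{opt}}{\sigma^2}\bigr)$. The cost is $c_i(S)=\max_{1\le k\le K}\frac12\log_2\bigl(1+\frac{\bar P_{i,\hat i}|g_{i,k}|^2}{\sigma^2}\bigr)$. The payoff is $\phi_i(S)=(v_i(S)-c_i(S))^+$ if $P_i^S>0$, and $\phi_i(S)=-\infty$ otherwise. If $|S|\ge2$ and $\boldsymbol G_S\boldsymbol G_S^H$ is singular (in particular whenever $2\le|S|\le K$), nulling the signal at all eavesdroppers is not available and $\phi_i(S)=-\infty$ for all $i\in S$. **Collections and Pareto order.** A collection is a set of mutually disjoint coalitions. It is a partition of $\mathcal{A}\subseteq\mathcal{N}$ if its union is $\mathcal{A}$. For a collection $\mathcal{R}$ and a player $j$ belonging to $R\in\mathcal{R}$, put $\Phi_j(\mathcal{R})=\phi_j(R)$. For two collections $\mathcal{R},\mathcal{S}$ partitioning the same $\mathcal{A}\subseteq\mathcal{N}$, $\mathcal{R}\triangleright\mathcal{S}$ means $\Phi_j(\mathcal{R})\ge\Phi_j(\mathcal{S})$ for all $j\in\mathcal{A}$, with strict inequality for at least one $j\in\mathcal{A}$. $\not\triangleright$ is its negation. **Algorithm.** - Merge rule: in the current partition, replace coalitions $S_1,\dots,S_l$ by $\bigcup_{j=1}^l S_j$ whenever $\{\bigcup_{j=1}^l S_j\}\triangleright\{S_1,\dots,S_l\}$. - Split rule: replace a coalition $\bigcup_{j=1}^l S_j$ (with $S_1,\dots,S_l$ disjoint and nonempty) by $S_1,\dots,S_l$ whenever $\{S_1,\dots,S_l\}\triangleright\{\bigcup_{j=1}^l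 S_j\}$. The algorithm starts from a partition of $\mathcal{N}$ (initially all singletons) and applies merge and split operations successively until no merge and no split is applicable. The partition reached is the final partition. **$\mathbb{D}_{hp}$-stability.** A partition $\mathcal{T}=\{T_1,\dots,T_l\}$ of $\mathcal{N}$ is $\mathbb{D}_{hp}$-stable if: 1. for each $i\in\{1,\dots,l\}$ and each partition $\{R_1,\dots,R_m\}$ of $T_i$, $\{R_1,\dots,R_m\}\not\triangleright\{T_i\}$; 2. for each nonempty $S\subseteq\{1,\dots,l\}$, $\{\bigcup_{i\in S}T_i\}\not\triangleright\{T_i\mid i\in S\}$. **$\mathbb{D}_c$-stability.** A partition $\mathcal{T}=\{T_1,\dots,T_l\}$ of $\mathcal{N}$ is $\mathbb{D}_c$-stable if: 1. for each $i\in\{1,\dots,l\}$ and each pair of disjoint (nonempty) coalitions $S_1,S_2$ with $S_1\cup S_2\subseteq T_i$, $\{S_1\cup S_2\}\triangleright\{S_1,S_2\}$; 2. for every coalition $G\subseteq\mathcal{N}$ that is $\mathcal{T}$-incompatible, meaning that $G\subseteq T_i$ holds for no $i\in\{1,\dots,l\}$, $\{G\}[\mathcal{T}]\triangleright\{G\}$, where $\{G\}[\mathcal{T}]=\{G\cap T_i\mid i\in\{1,\dots,l\},\,G\cap T_i\ne\emptyset\}$ is the projection of $G$ on $\mathcal{T}$. *)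

theory Defs
  imports
    "HOL-Analysis.Euclidean_Space"
    "HOL-Library.Extended_Real"
    "HOL-Library.Disjoint_Sets"
    "Jordan_Normal_Form.Gauss_Jordan_Elimination"
    "Jordan_Normal_Form.Schur_Decomposition"
begin

section \<open>Network model\<close>

record 'p network =
  num_users :: nat
  num_dests :: nat
  num_eavs :: nat
  dest :: "nat \<Rightarrow> nat"
  user_pos :: "nat \<Rightarrow> 'p"
  dest_pos :: "nat \<Rightarrow> 'p"
  eav_pos :: "nat \<Rightarrow> 'p"
  dest_phase :: "nat \<Rightarrow> nat \<Rightarrow> real"
  eav_phase :: "nat \<Rightarrow> nat \<Rightarrow> real"
  pathloss_exp :: real
  noise_var :: real
  slot_power :: real
  target_snr :: real

definition users :: "'p network \<Rightarrow> nat set" where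
  "users W = {1..num_users W}"

definition eavesdroppers :: "'p network \<Rightarrow> nat set" where
  "eavesdroppers W = {1..num_eavs W}"

definition destinations :: "'p network \<Rightarrow> nat set" where
  "destinations W = {1..num_dests W}"

text \<open>The field \<open>noise_var\<close> holds the variance itself, that is, the square of \<open>\<sigma>\<close>.\<close>

definition valid_network :: "'p network \<Rightarrow> bool" where
  "valid_network W \<longleftrightarrow>
     num_eavs W > 1 \<and>
     (\<forall>i\<in>users W. dest W i \<in> destinations W) \<and>
     inj_on (user_pos W) (users W) \<and>
     inj_on (dest_pos W) (destinations W) \<and>
     inj_on (eav_pos W) (eavesdroppers W) \<and>
     user_pos W ` users W \<inter> dest_pos W ` destinations W = {} \<and>
     user_pos W ` users W \<inter> eav_pos W ` eavesdroppers W = {} \<and>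
     dest_pos W ` destinations W \<inter> eav_pos W ` eavesdroppers W = {} \<and>
     pathloss_exp W > 0 \<and> noise_var W > 0 \<and> slot_power W > 0 \<and> target_snr W > 0"

definition dest_gain :: "'p::euclidean_space network \<Rightarrow> nat \<Rightarrow> complex" where
  "dest_gain W i =
     complex_of_real (dist (user_pos W i) (dest_pos W (dest W i)) powr (- pathloss_exp W / 2))
       * exp (\<i> * complex_of_real (dest_phase W i (dest W i)))"

definition eav_gain :: "'p::euclidean_space network \<Rightarrow> nat \<Rightarrow> nat \<Rightarrow> complex" where
  "eav_gain W i k =
     complex_of_real (dist (user_pos W i) (eav_pos W k) powr (- pathloss_exp W / 2))
       * exp (\<i> * complex_of_real (eav_phase W i k))"

section \<open>Payoffs\<close>

definition solo_payoff :: "'p::euclidean_space network \<Rightarrow> nat \<Rightarrow> real" where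
  "solo_payoff W i =
     max 0 (log 2 (1 + slot_power W * (cmod (dest_gain W i))\<^sup>2 / noise_var W)
            - Max ((\<lambda>k. log 2 (1 + slot_power W * (cmod (eav_gain W i k))\<^sup>2 / noise_var W))
                     ` eavesdroppers W))"

definition farthest :: "'p::euclidean_space network \<Rightarrow> nat set \<Rightarrow> nat \<Rightarrow> nat" where
  "farthest W S i = arg_max_on (\<lambda>j. dist (user_pos W i) (user_pos W j)) S"

definition exchange_power :: "'p::euclidean_space network \<Rightarrow> nat set \<Rightarrow> nat \<Rightarrow> real" where
  "exchange_power W S i =
     target_snr W * noise_var W
       * dist (user_pos W i) (user_pos W (farthest W S i)) powr pathloss_exp W"

definition remaining_power :: "'p::euclidean_space network \<Rightarrow> nat set \<Rightarrow> nat \<Rightarrow> real" where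
  "remaining_power W S i = max 0 (slot_power W - exchange_power W S i)"

text \<open>
  Column vectors are conjugate transposes of rows of gains, hence the entrywise \<open>cnj\<close>.
  Members of a coalition are enumerated in increasing order.
\<close>

definition dest_vec :: "'p::euclidean_space network \<Rightarrow> nat set \<Rightarrow> complex vec" where
  "dest_vec W S = vec_of_list (map (\<lambda>i. cnj (dest_gain W i)) (sorted_list_of_set S))"

definition eav_vec :: "'p::euclidean_space network \<Rightarrow> nat set \<Rightarrow> nat \<Rightarrow> complex vec" where
  "eav_vec W S k = vec_of_list (map (\<lambda>i. cnj (eav_gain W i k)) (sorted_list_of_set S))"

definition gain_mat :: "'p::euclidean_space network \<Rightarrow> nat set \<Rightarrow> complex mat" where
  "gain_mat W S =
     mat_adjoint (mat_of_cols (card S) (dest_vec W S # map (eav_vec W S) [1..<num_eavs W + 1]))"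

definition gram_mat :: "'p::euclidean_space network \<Rightarrow> nat set \<Rightarrow> complex mat" where
  "gram_mat W S = gain_mat W S * mat_adjoint (gain_mat W S)"

definition sel_vec :: "'p::euclidean_space network \<Rightarrow> complex vec" where
  "sel_vec W = unit_vec (num_eavs W + 1) 0"

text \<open>
  Since \<open>x \<bullet>c y\<close> is the product of \<open>x\<close> with the conjugate of \<open>y\<close>, it renders the conjugate
  transpose of \<open>y\<close> times \<open>x\<close>. The inverse of the Gram matrix is used only when it exists. That
  matrix is then Hermitian positive definite, so both scalars to which \<open>Re\<close> is applied
  below are real.
\<close>

definition gram_inv_sel :: "'p::euclidean_space network \<Rightarrow> nat set \<Rightarrow> complex vec" where
  "gram_inv_sel W S = the (mat_inverse (gram_mat W S)) *\<^sub>v sel_vec W"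

definition beam_scale :: "'p::euclidean_space network \<Rightarrow> nat set \<Rightarrow> nat \<Rightarrow> real" where
  "beam_scale W S i = sqrt (remaining_power W S i / Re (gram_inv_sel W S \<bullet>c sel_vec W))"

definition opt_weights :: "'p::euclidean_space network \<Rightarrow> nat set \<Rightarrow> nat \<Rightarrow> complex vec" where
  "opt_weights W S i =
     complex_of_real (beam_scale W S i) \<cdot>\<^sub>v (mat_adjoint (gain_mat W S) *\<^sub>v gram_inv_sel W S)"

definition coalition_gain :: "'p::euclidean_space network \<Rightarrow> nat set \<Rightarrow> nat \<Rightarrow> real" where
  "coalition_gain W S i =
     1 / 2 * log 2 (1 + Re ((dest_vec W S \<bullet>c opt_weights W S i)
                            * (opt_weights W S i \<bullet>c dest_vec W S)) / noise_var W)"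

definition coalition_cost :: "'p::euclidean_space network \<Rightarrow> nat set \<Rightarrow> nat \<Rightarrow> real" where
  "coalition_cost W S i =
     Max ((\<lambda>k. 1 / 2 * log 2 (1 + exchange_power W S i * (cmod (eav_gain W i k))\<^sup>2 / noise_var W))
            ` eavesdroppers W)"

text \<open>Intended for nonempty \<open>S \<subseteq> users W\<close> and \<open>i \<in> S\<close>.\<close>

definition payoff :: "'p::euclidean_space network \<Rightarrow> nat \<Rightarrow> nat set \<Rightarrow> ereal" where
  "payoff W i S =
     (if card S = 1 then ereal (solo_payoff W i)
      else if \<not> invertible_mat (gram_mat W S) then -\<infinity>
      else if remaining_power W S i > 0
        then ereal (max 0 (coalition_gain W S i - coalition_cost W S i))
      else -\<infinity>)"

section \<open>Collections, Pareto order, merge and split\<close>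

text \<open>
  From here on \<open>\<phi> i S\<close> is the payoff of player \<open>i\<close> in coalition \<open>S\<close>.
\<close>

definition player_payoff :: "(nat \<Rightarrow> nat set \<Rightarrow> ereal) \<Rightarrow> nat set set \<Rightarrow> nat \<Rightarrow> ereal" where
  "player_payoff \<phi> \<R> j = \<phi> j (THE R. R \<in> \<R> \<and> j \<in> R)"

text \<open>
  Only collections partitioning one and the same set of players are comparable; that set is
  necessarily the union of either collection.
\<close>

definition pareto :: "(nat \<Rightarrow> nat set \<Rightarrow> ereal) \<Rightarrow> nat set set \<Rightarrow> nat set set \<Rightarrow> bool" where
  "pareto \<phi> \<R> \<S> \<longleftrightarrow>
     (\<exists>A. partition_on A \<R> \<and> partition_on A \<S> \<and>
          (\<forall>j\<in>A. player_payoff \<phi> \<R> j \<ge> player_payoff \<phi> \<S> j) \<and>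
          (\<exists>j\<in>A. player_payoff \<phi> \<R> j > player_payoff \<phi> \<S> j))"

definition merge_step :: "(nat \<Rightarrow> nat set \<Rightarrow> ereal) \<Rightarrow> nat set set \<Rightarrow> nat set set \<Rightarrow> bool" where
  "merge_step \<phi> \<P> \<Q> \<longleftrightarrow>
     (\<exists>\<C>. \<C> \<noteq> {} \<and> \<C> \<subseteq> \<P> \<and> pareto \<phi> {\<Union>\<C>} \<C> \<and> \<Q> = (\<P> - \<C>) \<union> {\<Union>\<C>})"

definition split_step :: "(nat \<Rightarrow> nat set \<Rightarrow> ereal) \<Rightarrow> nat set set \<Rightarrow> nat set set \<Rightarrow> bool" where
  "split_step \<phi> \<P> \<Q> \<longleftrightarrow>
     (\<exists>S \<C>. S \<in> \<P> \<and> partition_on S \<C> \<and> pareto \<phi> \<C> {S} \<and> \<Q> = (\<P> - {S}) \<union> \<C>)"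

definition step :: "(nat \<Rightarrow> nat set \<Rightarrow> ereal) \<Rightarrow> nat set set \<Rightarrow> nat set set \<Rightarrow> bool" where
  "step \<phi> \<P> \<Q> \<longleftrightarrow> merge_step \<phi> \<P> \<Q> \<or> split_step \<phi> \<P> \<Q>"

text \<open>
  The order in which applicable operations are performed is left open, so a start partition may
  admit several runs; \<open>final_partition \<phi> \<P> \<Q>\<close> says that some run from \<open>\<P>\<close> stops at \<open>\<Q>\<close>.
\<close>

definition final_partition :: "(nat \<Rightarrow> nat set \<Rightarrow> ereal) \<Rightarrow> nat set set \<Rightarrow> nat set set \<Rightarrow> bool" where
  "final_partition \<phi> \<P> \<Q> \<longleftrightarrow> (step \<phi>)\<^sup>*\<^sup>* \<P> \<Q> \<and> \<not> (\<exists>\<Q>'. step \<phi> \<Q> \<Q>')"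

definition infinite_run :: "(nat \<Rightarrow> nat set \<Rightarrow> ereal) \<Rightarrow> nat set set \<Rightarrow> bool" where
  "infinite_run \<phi> \<P> \<longleftrightarrow> (\<exists>r :: nat \<Rightarrow> nat set set. r 0 = \<P> \<and> (\<forall>n. step \<phi> (r n) (r (Suc n))))"

section \<open>Stability\<close>

definition Dhp_stable :: "(nat \<Rightarrow> nat set \<Rightarrow> ereal) \<Rightarrow> nat set \<Rightarrow> nat set set \<Rightarrow> bool" where
  "Dhp_stable \<phi> N \<T> \<longleftrightarrow>
     partition_on N \<T> \<and>
     (\<forall>T\<in>\<T>. \<forall>\<R>. partition_on T \<R> \<longrightarrow> \<not> pareto \<phi> \<R> {T}) \<and>
     (\<forall>\<S>. \<S> \<noteq> {} \<and> \<S> \<subseteq> \<T> \<longrightarrow> \<not> pareto \<phi> {\<Union>\<S>} \<S>)"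

definition projection :: "nat set \<Rightarrow> nat set set \<Rightarrow> nat set set" where
  "projection G \<T> = {G \<inter> T | T. T \<in> \<T> \<and> G \<inter> T \<noteq> {}}"

definition Dc_stable :: "(nat \<Rightarrow> nat set \<Rightarrow> ereal) \<Rightarrow> nat set \<Rightarrow> nat set set \<Rightarrow> bool" where
  "Dc_stable \<phi> N \<T> \<longleftrightarrow>
     partition_on N \<T> \<and>
     (\<forall>T\<in>\<T>. \<forall>S1 S2. S1 \<noteq> {} \<and> S2 \<noteq> {} \<and> S1 \<inter> S2 = {} \<and> S1 \<union> S2 \<subseteq> T
        \<longrightarrow> pareto \<phi> {S1 \<union> S2} {S1, S2}) \<and>
     (\<forall>G. G \<noteq> {} \<and> G \<subseteq> N \<and> \<not> (\<exists>T\<in>\<T>. G \<subseteq> T) \<longrightarrow> pareto \<phi> (projection G \<T>) {G})"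

end

theory Submission
  imports Defs
begin

text \<open>
  Every operation is a strict Pareto improvement, so no partition of the finite player set recurs
  and every run stops; a partition where it stops satisfies both stability conditions for
  \<open>\<D>\<^sub>h\<^sub>p\<close> literally. If a \<open>\<D>\<^sub>c\<close>-stable partition exists,
  a partition different from it either contains a coalition meeting several of its blocks, which
  splits along them, or refines it, in which case the pieces of one block merge.
  Optimality comes from passing through the common refinement of the two partitions.
\<close>

section \<open>Cells of partitions and the Pareto order\<close>

lemma partition_on_cell_unique:
  assumes "partition_on A \<R>" "R \<in> \<R>" "R' \<in> \<R>" "j \<in> R" "j \<in> R'"
  shows "R = R'"
  using assms partition_onD2[OF assms(1)] by (auto simp: disjoint_def)

text \<open>A cell of \<open>\<S>\<close> outside \<open>\<R>\<close> would contain a point already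
  covered by a cell of \<open>\<R>\<close>, and distinct cells of \<open>\<S>\<close> share no
  point. It is used to see that a partition other than a stable one misses a whole block of
  it.\<close>

lemma partition_on_subset_eq:
  assumes "partition_on A \<R>" "partition_on A \<S>" "\<R> \<subseteq> \<S>"
  shows "\<R> = \<S>"
proof (intro equalityI assms(3) subsetI)
  fix S assume S: "S \<in> \<S>"
  then have "S \<noteq> {}"
    using assms(2) by (auto simp: partition_on_def)
  then obtain j where j: "j \<in> S"
    by blast
  then have "j \<in> \<Union>\<R>"
    using S assms(1,2) by (auto simp: partition_on_def)
  then obtain R where "R \<in> \<R>" "j \<in> R"
    by blast
  then show "S \<in> \<R>"
    using partition_on_cell_unique[OF assms(2) S _ j] assms(3) by auto
qed

lemma player_payoff_eq:
  assumes "partition_on A \<R>" "R \<in> \<R>" "j \<in> R"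
  shows "player_payoff \<phi> \<R> j = \<phi> j R"
proof -
  have "(THE R. R \<in> \<R> \<and> j \<in> R) = R"
    using assms partition_on_cell_unique[OF assms(1)] by (intro the_equality) auto
  then show ?thesis
    by (simp add: player_payoff_def)
qed

text \<open>Together with \<open>pareto_le\<close> and \<open>pareto_strict\<close>, this trades the
  definite description in \<open>player_payoff\<close> for explicit cells, so that later arguments
  only compare payoffs of two cells sharing a player.\<close>

lemma paretoI:
  assumes \<R>: "partition_on A \<R>" and \<S>: "partition_on A \<S>"
    and le: "\<And>j R S. R \<in> \<R> \<Longrightarrow> S \<in> \<S> \<Longrightarrow> j \<in> R \<Longrightarrow> j \<in> S \<Longrightarrow> \<phi> j S \<le> \<phi> j R"
    and strict: "R\<^sub>0 \<in> \<R>" "S\<^sub>0 \<in> \<S>" "i \<in> R\<^sub>0" "i \<in> S\<^sub>0" "\<phi> i S\<^sub>0 < \<phi> i R\<^sub>0"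
  shows "pareto \<phi> \<R> \<S>"
  unfolding pareto_def
proof (intro exI[of _ A] conjI ballI \<R> \<S>)
  fix j assume "j \<in> A"
  then obtain R S where "R \<in> \<R>" "S \<in> \<S>" "j \<in> R" "j \<in> S"
    using \<R> \<S> by (metis UnionE partition_onD1)
  then show "player_payoff \<phi> \<S> j \<le> player_payoff \<phi> \<R> j"
    using le by (simp add: player_payoff_eq[OF \<R>] player_payoff_eq[OF \<S>])
next
  have "i \<in> A"
    using strict \<R> by (auto simp: partition_on_def)
  moreover have "player_payoff \<phi> \<S> i < player_payoff \<phi> \<R> i"
    using strict by (simp add: player_payoff_eq[OF \<R>] player_payoff_eq[OF \<S>])
  ultimately show "\<exists>j\<in>A. player_payoff \<phi> \<S> j < player_payoff \<phi> \<R> j"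
    by blast
qed

lemma pareto_le:
  assumes "pareto \<phi> \<R> \<S>" "R \<in> \<R>" "S \<in> \<S>" "j \<in> R" "j \<in> S"
  shows "\<phi> j S \<le> \<phi> j R"
proof -
  obtain A where "partition_on A \<R>" "partition_on A \<S>"
    and "\<forall>j\<in>A. player_payoff \<phi> \<S> j \<le> player_payoff \<phi> \<R> j"
    using assms(1) by (auto simp: pareto_def)
  moreover from this have "j \<in> A"
    using assms by (auto simp: partition_on_def)
  ultimately show ?thesis
    using assms player_payoff_eq by metis
qed

lemma pareto_strict:
  assumes "pareto \<phi> \<R> \<S>"
  obtains j R S where "R \<in> \<R>" "S \<in> \<S>" "j \<in> R" "j \<in> S" "\<phi> j S < \<phi> j R"
proof -
  obtain A j where *: "partition_on A \<R>" "partition_on A \<S>" "j \<in> A"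
    and less: "player_payoff \<phi> \<S> j < player_payoff \<phi> \<R> j"
    using assms by (auto simp: pareto_def)
  then obtain R S where "R \<in> \<R>" "S \<in> \<S>" "j \<in> R" "j \<in> S"
    by (metis UnionE partition_onD1)
  then show thesis
    using that less *(1,2) player_payoff_eq by metis
qed

lemma pareto_irrefl: "\<not> pareto \<phi> \<R> \<R>"
  by (auto simp: pareto_def)

lemma pareto_trans:
  assumes "pareto \<phi> \<R> \<S>" "pareto \<phi> \<S> \<T>"
  shows "pareto \<phi> \<R> \<T>"
proof -
  obtain A where A: "partition_on A \<R>" "partition_on A \<S>"
    "\<forall>j\<in>A. player_payoff \<phi> \<S> j \<le> player_payoff \<phi> \<R> j"
    "\<exists>j\<in>A. player_payoff \<phi> \<S> j < player_payoff \<phi> \<R> j"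
    using assms(1) by (auto simp: pareto_def)
  obtain B where B: "partition_on B \<S>" "partition_on B \<T>"
    "\<forall>j\<in>B. player_payoff \<phi> \<T> j \<le> player_payoff \<phi> \<S> j"
    using assms(2) by (auto simp: pareto_def)
  \<comment> \<open>Both sets are the union of \<open>\<S>\<close>, so the two comparisons concern
    the same players.\<close>
  have "B = A"
    using A(2) B(1) by (simp add: partition_on_def)
  show ?thesis
    unfolding pareto_def
  proof (intro exI[of _ A] conjI ballI)
    show "partition_on A \<R>" "partition_on A \<T>"
      using A(1) B(2) \<open>B = A\<close> by simp_all
    show "player_payoff \<phi> \<T> j \<le> player_payoff \<phi> \<R> j" if "j \<in> A" for j
      using A(3) B(3) \<open>B = A\<close> that order_trans[of "player_payoff \<phi> \<T> j"] by auto
    obtain i where "i \<in> A" "player_payoff \<phi> \<S> i < player_payoff \<phi> \<R> i"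
      using A(4) by auto
    moreover from this have "player_payoff \<phi> \<T> i \<le> player_payoff \<phi> \<S> i"
      using B(3) \<open>B = A\<close> by simp
    ultimately show "\<exists>j\<in>A. player_payoff \<phi> \<T> j < player_payoff \<phi> \<R> j"
      by (auto intro: le_less_trans)
  qed
qed

section \<open>Replacing some cells of a partition\<close>

lemma replace_partition_on:
  assumes "partition_on A \<P>" "\<C> \<subseteq> \<P>" "partition_on B \<C>" "partition_on B \<D>"
  shows "partition_on A ((\<P> - \<C>) \<union> \<D>)"
proof (rule partition_onI)
  have "\<Union>\<D> = \<Union>\<C>"
    using assms(3,4) by (simp add: partition_on_def)
  then show "\<Union> ((\<P> - \<C>) \<union> \<D>) = A"
    using assms(1,2) by (auto simp: partition_on_def)
  \<comment> \<open>A common point would also lie in a cell of \<open>\<C>\<close>, as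
    \<open>\<C>\<close> and \<open>\<D>\<close> cover the same set. That cell would meet
    \<open>R\<close> within \<open>\<P>\<close>, forcing \<open>R \<in> \<C>\<close>.\<close>
  have outside: "R \<inter> D = {}" if RD: "R \<in> \<P> - \<C>" "D \<in> \<D>" for R D
  proof (rule ccontr)
    assume "R \<inter> D \<noteq> {}"
    then obtain j where "j \<in> R" "j \<in> D"
      by blast
    moreover from this obtain C where "C \<in> \<C>" "j \<in> C"
      using \<open>\<Union>\<D> = \<Union>\<C>\<close> RD(2) by blast
    ultimately show False
      using partition_on_cell_unique[OF assms(1), of R C j] assms(2) RD(1) by auto
  qed
  show "disjnt R R'" if "R \<in> (\<P> - \<C>) \<union> \<D>" "R' \<in> (\<P> - \<C>) \<union> \<D>" "R \<noteq> R'" for R R'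
    using that outside[of R R'] outside[of R' R]
      disjointD[OF partition_onD2[OF assms(1)], of R R']
      disjointD[OF partition_onD2[OF assms(4)], of R R']
    by (auto simp: disjnt_def)
  show "{} \<notin> (\<P> - \<C>) \<union> \<D>"
    using assms(1,4) by (auto simp: partition_on_def)
qed

text \<open>A local improvement is a global one: players covered by \<open>\<C>\<close> fare as in
  the comparison of \<open>\<D>\<close> with \<open>\<C>\<close>, and all others keep their
  cell.\<close>

lemma replace_pareto:
  assumes "partition_on A \<P>" "\<C> \<subseteq> \<P>" "pareto \<phi> \<D> \<C>"
  shows "pareto \<phi> ((\<P> - \<C>) \<union> \<D>) \<P>" "partition_on A ((\<P> - \<C>) \<union> \<D>)"
proof -
  obtain B where B: "partition_on B \<D>" "partition_on B \<C>"
    using assms(3) by (auto simp: pareto_def)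
  show new: "partition_on A ((\<P> - \<C>) \<union> \<D>)"
    using replace_partition_on[OF assms(1,2) B(2,1)] .
  obtain i R\<^sub>0 S\<^sub>0 where strict: "R\<^sub>0 \<in> \<D>" "S\<^sub>0 \<in> \<C>" "i \<in> R\<^sub>0" "i \<in> S\<^sub>0" "\<phi> i S\<^sub>0 < \<phi> i R\<^sub>0"
    using pareto_strict[OF assms(3)] .
  show "pareto \<phi> ((\<P> - \<C>) \<union> \<D>) \<P>"
  proof (rule paretoI[where R\<^sub>0 = R\<^sub>0 and S\<^sub>0 = S\<^sub>0 and i = i, OF new assms(1)])
    fix j R S assume *: "R \<in> (\<P> - \<C>) \<union> \<D>" "S \<in> \<P>" "j \<in> R" "j \<in> S"
    show "\<phi> j S \<le> \<phi> j R"
    proof (cases "R \<in> \<D>")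
      case True
      then obtain C where C: "C \<in> \<C>" "j \<in> C"
        using B *(3) by (metis UnionE UnionI partition_onD1)
      then have "C = S"
        using partition_on_cell_unique[OF assms(1), of C S j] assms(2) * by auto
      then show ?thesis
        using pareto_le[OF assms(3) True C(1)] C * by simp
    next
      case False
      then show ?thesis
        using partition_on_cell_unique[OF assms(1), of R S j] * by simp
    qed
  qed (use strict assms(2) in auto)
qed

text \<open>Merge and split are one operation, replacing \<open>\<C>\<close> by \<open>\<D>\<close>:
  a merge has \<open>\<D> = {\<Union>\<C>}\<close>, a split has \<open>\<C> = {S}\<close>.\<close>

lemma step_pareto:
  assumes "partition_on A \<P>" "step \<phi> \<P> \<Q>"
  shows "pareto \<phi> \<Q> \<P>" "partition_on A \<Q>"
proof -
  obtain \<C> \<D> where "\<C> \<subseteq> \<P>" "pareto \<phi> \<D> \<C>" "\<Q> = (\<P> - \<C>) \<union> \<D>"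
    using assms(2) unfolding step_def merge_step_def split_step_def by blast
  then show "pareto \<phi> \<Q> \<P>" "partition_on A \<Q>"
    using replace_pareto[OF assms(1)] by auto
qed

lemma steps_partition_on:
  assumes "(step \<phi>)\<^sup>*\<^sup>* \<P> \<Q>" "partition_on A \<P>"
  shows "partition_on A \<Q>"
  using assms by (induction rule: rtranclp_induct) (auto intro: step_pareto(2))

section \<open>Termination\<close>

text \<open>Steps lie inside Pareto dominance between partitions of \<open>A\<close>, which is
  transitive and irreflexive, hence acyclic. A finite set has finitely many partitions, and a finite
  acyclic relation is well-founded.\<close>

lemma wf_step:
  assumes "finite A"
  shows "wf {(\<Q>, \<P>). partition_on A \<P> \<and> step \<phi> \<P> \<Q>}"
proof -
  let ?r = "{(\<Q>, \<P>). partition_on A \<P> \<and> partition_on A \<Q> \<and> pareto \<phi> \<Q> \<P>}"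
  have "?r \<subseteq> {\<P>. partition_on A \<P>} \<times> {\<P>. partition_on A \<P>}"
    by auto
  then have "finite ?r"
    using finitely_many_partition_on[OF assms] finite_subset by blast
  moreover have "trans ?r"
    by (auto intro!: transI intro: pareto_trans)
  then have "acyclic ?r"
    using pareto_irrefl by (auto simp: acyclic_irrefl irrefl_def)
  ultimately have "wf ?r"
    by (rule finite_acyclic_wf)
  then show ?thesis
    by (rule wf_subset) (auto intro: step_pareto)
qed

lemma no_infinite_run:
  assumes "finite A" "partition_on A \<P>"
  shows "\<not> infinite_run \<phi> \<P>"
proof
  assume "infinite_run \<phi> \<P>"
  then obtain r where r: "r 0 = \<P>" "\<And>n. step \<phi> (r n) (r (Suc n))"
    by (auto simp: infinite_run_def)
  \<comment> \<open>The relation of \<open>wf_step\<close> admits only steps out of partitions of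
    \<open>A\<close>, so this property is carried along the run.\<close>
  have "partition_on A (r n)" for n
    using assms(2) r by (induction n) (auto intro: step_pareto(2))
  then show False
    using wf_step[OF assms(1), of \<phi>] r(2) unfolding wf_iff_no_infinite_down_chain by blast
qed

lemma final_partition_exists:
  assumes "finite A" "partition_on A \<P>"
  shows "\<exists>\<Q>. final_partition \<phi> \<P> \<Q>"
  using assms(2)
proof (induction \<P> rule: wf_induct_rule[OF wf_step[OF assms(1), of \<phi>]])
  case (1 \<P>)
  show ?case
  proof (cases "\<exists>\<P>'. step \<phi> \<P> \<P>'")
    case True
    then obtain \<P>' where step: "step \<phi> \<P> \<P>'"
      by blast
    then obtain \<Q> where "final_partition \<phi> \<P>' \<Q>"
      using 1 step_pareto(2) by blast
    then show ?thesis
      using step by (auto simp: final_partition_def intro: converse_rtranclp_into_rtranclp)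
  qed (auto simp: final_partition_def)
qed

section \<open>Stability of final partitions\<close>

lemma final_partition_Dhp_stable:
  assumes "final_partition \<phi> \<P> \<Q>" "partition_on A \<P>"
  shows "Dhp_stable \<phi> A \<Q>"
  unfolding Dhp_stable_def
proof (intro conjI ballI allI impI)
  have stuck: "\<not> merge_step \<phi> \<Q> \<Q>'" "\<not> split_step \<phi> \<Q> \<Q>'" for \<Q>'
    using assms(1) by (auto simp: final_partition_def step_def)
  show "partition_on A \<Q>"
    using assms steps_partition_on by (auto simp: final_partition_def)
  show "\<not> pareto \<phi> \<R> {T}" if "T \<in> \<Q>" "partition_on T \<R>" for T \<R>
    using stuck(2) that unfolding split_step_def by blast
  show "\<not> pareto \<phi> {\<Union>\<S>} \<S>" if "\<S> \<noteq> {} \<and> \<S> \<subseteq> \<Q>" for \<S>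
    using stuck(1) that unfolding merge_step_def by blast
qed

section \<open>Payoff comparisons under D_c-stability\<close>

lemma Dc_stable_partition_on: "Dc_stable \<phi> A \<T> \<Longrightarrow> partition_on A \<T>"
  by (simp add: Dc_stable_def)

lemma Dc_stable_pareto_Un:
  assumes "Dc_stable \<phi> A \<T>" "T \<in> \<T>" "R \<subset> S" "S \<subseteq> T" "R \<noteq> {}"
  shows "pareto \<phi> {S} {R, S - R}"
proof -
  have *: "R \<noteq> {} \<and> S - R \<noteq> {} \<and> R \<inter> (S - R) = {} \<and> R \<union> (S - R) \<subseteq> T"
    "R \<union> (S - R) = S"
    using assms by auto
  have "\<forall>S1 S2. S1 \<noteq> {} \<and> S2 \<noteq> {} \<and> S1 \<inter> S2 = {} \<and> S1 \<union> S2 \<subseteq> T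
      \<longrightarrow> pareto \<phi> {S1 \<union> S2} {S1, S2}"
    using assms(1,2) by (simp add: Dc_stable_def)
  then have "pareto \<phi> {R \<union> (S - R)} {R, S - R}"
    using *(1) by (elim allE impE)
  then show ?thesis
    unfolding *(2) .
qed

lemma Dc_stable_pareto_projection:
  assumes "Dc_stable \<phi> A \<T>" "G \<noteq> {}" "G \<subseteq> A" "\<not> (\<exists>T\<in>\<T>. G \<subseteq> T)"
  shows "pareto \<phi> (projection G \<T>) {G}"
  using assms by (simp add: Dc_stable_def)

text \<open>Condition 1 makes the merger of \<open>R\<close> with \<open>S - R\<close> an
  improvement. The case \<open>R = S\<close> stands apart because \<open>S - R\<close> is then
  empty.\<close>

lemma Dc_stable_mono:
  assumes "Dc_stable \<phi> A \<T>" "T \<in> \<T>" "R \<subseteq> S" "S \<subseteq> T" "j \<in> R"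
  shows "\<phi> j R \<le> \<phi> j S"
proof (cases "R = S")
  case False
  then have "pareto \<phi> {S} {R, S - R}"
    using assms Dc_stable_pareto_Un[OF assms(1,2), of R S] by auto
  then show ?thesis
    using pareto_le[of \<phi> "{S}" "{R, S - R}" S R j] assms by auto
qed simp

text \<open>Condition 2 covers only incompatible \<open>G\<close>. A compatible \<open>G\<close>
  containing \<open>j\<close> lies in \<open>T\<close> itself, so that
  \<open>G \<inter> T = G\<close>.\<close>

lemma Dc_stable_le_Int:
  assumes "Dc_stable \<phi> A \<T>" "T \<in> \<T>" "G \<subseteq> A" "j \<in> G" "j \<in> T"
  shows "\<phi> j G \<le> \<phi> j (G \<inter> T)"
proof (cases "\<exists>T\<in>\<T>. G \<subseteq> T")
  case True
  then obtain T' where T': "T' \<in> \<T>" "G \<subseteq> T'"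
    by blast
  moreover have "T' = T"
    using partition_on_cell_unique[OF Dc_stable_partition_on[OF assms(1)], of T' T j] assms T'
    by auto
  ultimately show ?thesis
    by (simp add: Int_absorb2)
next
  case False
  then have "pareto \<phi> (projection G \<T>) {G}"
    using assms Dc_stable_pareto_projection[of \<phi> A \<T> G] by auto
  moreover have "G \<inter> T \<in> projection G \<T>"
    using assms unfolding projection_def by blast
  ultimately show ?thesis
    using pareto_le[of \<phi> "projection G \<T>" "{G}" "G \<inter> T" G j] assms by simp
qed

text \<open>Condition 1 speaks of unions of two coalitions only. Applied to one cell
  \<open>B\<close> and its complement in \<open>T\<close>, it yields a strictly gaining player;
  monotonicity then passes from these two halves to the finer \<open>\<C>\<close>.\<close>

lemma Dc_stable_merge:
  assumes "Dc_stable \<phi> A \<T>" "T \<in> \<T>" "partition_on T \<C>" "\<C> \<noteq> {T}"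
  shows "pareto \<phi> {T} \<C>"
proof -
  have "T \<noteq> {}"
    using Dc_stable_partition_on[OF assms(1)] assms(2) by (auto simp: partition_on_def)
  have un: "\<Union>\<C> = T"
    using assms(3) by (simp add: partition_on_def)
  \<comment> \<open>Otherwise every cell would be \<open>T\<close>, and since \<open>T\<close> is
    nonempty \<open>\<C>\<close> would be \<open>{T}\<close>.\<close>
  then obtain B where B: "B \<in> \<C>" "B \<noteq> T"
    using assms(4) \<open>T \<noteq> {}\<close> by blast
  then have "B \<noteq> {}" "B \<subseteq> T"
    using assms(3) by (auto simp: partition_on_def)
  then have "pareto \<phi> {T} {B, T - B}"
    using Dc_stable_pareto_Un[OF assms(1,2), of B T] B by auto
  then obtain j S where j: "S = B \<or> S = T - B" "j \<in> S" "j \<in> T" "\<phi> j S < \<phi> j T"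
    by (elim pareto_strict) auto
  then obtain C where C: "C \<in> \<C>" "j \<in> C"
    using un by blast
  \<comment> \<open>Each cell is \<open>B\<close> or lies in \<open>T - B\<close>. As
    \<open>C\<close> is contained in the half \<open>S\<close>, its payoff to \<open>j\<close> is at
    most that of \<open>S\<close>, so the strict gain in \<open>T\<close> carries over to
    \<open>C\<close>.\<close>
  have "C \<subseteq> S"
  proof (cases "C = B")
    case True
    then show ?thesis
      using j(1,2) C(2) by auto
  next
    case False
    then have "C \<inter> B = {}"
      using C(1) B(1) partition_onD2[OF assms(3)] by (auto simp: disjoint_def)
    then show ?thesis
      using j(1,2) C un by blast
  qed
  then have "\<phi> j C \<le> \<phi> j S"
    using Dc_stable_mono[OF assms(1,2), of C S j] C j(1) \<open>B \<subseteq> T\<close> by auto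
  then have less: "\<phi> j C < \<phi> j T"
    using j(4) by simp
  show ?thesis
  proof (rule paretoI[where R\<^sub>0 = T and S\<^sub>0 = C and i = j])
    show "partition_on T {T}"
      using partition_on_space[OF \<open>T \<noteq> {}\<close>] .
    show "\<phi> i B \<le> \<phi> i R" if "R \<in> {T}" "B \<in> \<C>" "i \<in> R" "i \<in> B" for i R B
      using Dc_stable_mono[OF assms(1,2), of B T i] un that by auto
  qed (use assms(3) C j(3) less in auto)
qed

text \<open>Serves twice: either case gives a step that \<open>\<Q>\<close> still admits, and either
  case supplies a player who strictly gains in \<open>\<T>\<close>.\<close>

lemma Dc_stable_cases:
  assumes "Dc_stable \<phi> A \<T>" "partition_on A \<Q>" "\<Q> \<noteq> \<T>"
  obtains (split) G where "G \<in> \<Q>" "partition_on G (projection G \<T>)"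
      "pareto \<phi> (projection G \<T>) {G}"
  | (merge) T \<C> where "T \<in> \<T>" "\<C> \<subseteq> \<Q>" "\<C> \<noteq> {}" "partition_on T \<C>" "pareto \<phi> {T} \<C>"
proof -
  note part = Dc_stable_partition_on[OF assms(1)]
  show thesis
  proof (cases "\<forall>G\<in>\<Q>. \<exists>T\<in>\<T>. G \<subseteq> T")
    case False
    then obtain G where G: "G \<in> \<Q>" "\<not> (\<exists>T\<in>\<T>. G \<subseteq> T)"
      by blast
    moreover have "G \<noteq> {}" "G \<subseteq> A"
      using G(1) assms(2) by (auto simp: partition_on_def)
    ultimately have pareto: "pareto \<phi> (projection G \<T>) {G}"
      using Dc_stable_pareto_projection[OF assms(1)] by simp
    \<comment> \<open>The player set hidden in \<open>pareto\<close> is the union of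
      \<open>{G}\<close>, hence \<open>G\<close>.\<close>
    then have "partition_on G (projection G \<T>)"
      unfolding pareto_def partition_on_def by auto
    then show thesis
      using split G(1) pareto by blast
  next
    case True
    \<comment> \<open>Here \<open>\<Q>\<close> refines \<open>\<T>\<close>. Were every block of
      \<open>\<T>\<close> a cell of \<open>\<Q>\<close>, the two partitions would coincide.\<close>
    obtain T where T: "T \<in> \<T>" "T \<notin> \<Q>"
      using partition_on_subset_eq[OF part assms(2)] assms(3) by blast
    define \<C> where "\<C> = {G \<in> \<Q>. G \<subseteq> T}"
    have sub: "\<C> \<subseteq> \<Q>"
      by (auto simp: \<C>_def)
    \<comment> \<open>A cell of \<open>\<Q>\<close> meeting \<open>T\<close> lies in some block, and
      that block can only be \<open>T\<close>.\<close>
    have "T \<subseteq> \<Union>\<C>"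
    proof
      fix j assume "j \<in> T"
      then obtain G where G: "G \<in> \<Q>" "j \<in> G"
        using T(1) part assms(2) by (metis UnionE UnionI partition_onD1)
      then obtain T' where "T' \<in> \<T>" "G \<subseteq> T'"
        using True by blast
      moreover from this have "T' = T"
        using partition_on_cell_unique[OF part, of T' T j] T(1) G(2) \<open>j \<in> T\<close> by auto
      ultimately show "j \<in> \<Union>\<C>"
        using G by (auto simp: \<C>_def)
    qed
    then have "\<Union>\<C> = T"
      by (auto simp: \<C>_def)
    then have \<C>: "partition_on T \<C>"
      using assms(2) sub by (auto simp: partition_on_def disjoint_def)
    moreover have "\<C> \<noteq> {T}"
      using T(2) sub by blast
    ultimately have "pareto \<phi> {T} \<C>"
      using Dc_stable_merge[OF assms(1) T(1)] by blast
    moreover have "\<C> \<noteq> {}"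
      using \<open>\<Union>\<C> = T\<close> T(1) part by (auto simp: partition_on_def)
    ultimately show thesis
      using merge[OF T(1) sub _ \<C>] by blast
  qed
qed

section \<open>Uniqueness of the final partition and optimality\<close>

lemma Dc_stable_final_partition_eq:
  assumes "Dc_stable \<phi> A \<T>" "partition_on A \<P>" "final_partition \<phi> \<P> \<Q>"
  shows "\<Q> = \<T>"
proof (rule ccontr)
  assume "\<Q> \<noteq> \<T>"
  have "partition_on A \<Q>"
    using assms(2,3) steps_partition_on by (auto simp: final_partition_def)
  from assms(1) this \<open>\<Q> \<noteq> \<T>\<close> have "\<exists>\<Q>'. step \<phi> \<Q> \<Q>'"
  proof (cases rule: Dc_stable_cases)
    case (split G)
    then show ?thesis
      unfolding step_def split_step_def by blast
  next
    case (merge T \<C>)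
    moreover from this have "\<Union>\<C> = T"
      by (simp add: partition_on_def)
    ultimately show ?thesis
      unfolding step_def merge_step_def by blast
  qed
  then show False
    using assms(3) by (simp add: final_partition_def)
qed

text \<open>For a player \<open>j\<close> in cells \<open>G\<close> and \<open>T\<close>, condition
  2 compares \<open>G\<close> with \<open>G \<inter> T\<close> and condition 1 compares
  \<open>G \<inter> T\<close> with \<open>T\<close>. Both bounds are weak; strictness for one player
  comes from \<open>Dc_stable_cases\<close>.\<close>

lemma Dc_stable_optimal:
  assumes "Dc_stable \<phi> A \<T>" "partition_on A \<Q>" "\<Q> \<noteq> \<T>"
  shows "pareto \<phi> \<T> \<Q>"
proof -
  note part = Dc_stable_partition_on[OF assms(1)]
  have Int_le: "\<phi> j (G \<inter> T) \<le> \<phi> j T" if "T \<in> \<T>" "j \<in> G" "j \<in> T" for j G T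
    using Dc_stable_mono[OF assms(1) that(1), of "G \<inter> T" T j] that by auto
  have le: "\<phi> j G \<le> \<phi> j T" if "T \<in> \<T>" "G \<in> \<Q>" "j \<in> T" "j \<in> G" for j G T
  proof -
    have "G \<subseteq> A"
      using that(2) assms(2) by (auto simp: partition_on_def)
    then have "\<phi> j G \<le> \<phi> j (G \<inter> T)"
      using Dc_stable_le_Int[OF assms(1)] that by simp
    also have "\<dots> \<le> \<phi> j T"
      using Int_le that by simp
    finally show ?thesis .
  qed
  from assms obtain j T G where "T \<in> \<T>" "G \<in> \<Q>" "j \<in> T" "j \<in> G" "\<phi> j G < \<phi> j T"
  proof (cases rule: Dc_stable_cases)
    case (split G)
    from split(3) obtain j R where "R \<in> projection G \<T>" "j \<in> R" "\<phi> j G < \<phi> j R"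
      by (elim pareto_strict) auto
    then obtain T where T: "T \<in> \<T>" "j \<in> G" "j \<in> T" "\<phi> j G < \<phi> j (G \<inter> T)"
      by (auto simp: projection_def)
    \<comment> \<open>The gain is already strict at \<open>G \<inter> T\<close>, and enlarging to
      \<open>T\<close> keeps it.\<close>
    then have "\<phi> j G < \<phi> j T"
      using Int_le[of T j G] by (auto intro: less_le_trans)
    then show ?thesis
      using that T split(1) by blast
  next
    case (merge T \<C>)
    \<comment> \<open>The cells of \<open>\<C>\<close> are cells of \<open>\<Q>\<close>, so this
      strict gain is one over \<open>\<Q>\<close>.\<close>
    from merge(5) obtain j G where "G \<in> \<C>" "j \<in> T" "j \<in> G" "\<phi> j G < \<phi> j T"
      by (elim pareto_strict) auto
    then show ?thesis
      using that merge(1,2) by blast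
  qed
  then show ?thesis
    by (intro paretoI[where R\<^sub>0 = T and S\<^sub>0 = G and i = j, OF part assms(2)] le)
qed

theorem lemma1:
  fixes W :: "'p::euclidean_space network" and \<P> :: "nat set set"
  assumes "valid_network W"
    and "partition_on (users W) \<P>"
  shows "\<not> infinite_run (payoff W) \<P>
    \<and> (\<exists>\<Q>. final_partition (payoff W) \<P> \<Q>)
    \<and> (\<forall>\<T>. Dc_stable (payoff W) (users W) \<T> \<longrightarrow>
         (\<forall>\<Q>. final_partition (payoff W) \<P> \<Q> \<longrightarrow> \<Q> = \<T>) \<and>
         (\<forall>\<T>'. partition_on (users W) \<T>' \<and> \<T>' \<noteq> \<T> \<longrightarrow> pareto (payoff W) \<T> \<T>'))
    \<and> ((\<nexists>\<T>. Dc_stable (payoff W) (users W) \<T>) \<longrightarrow>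
         (\<forall>\<Q>. final_partition (payoff W) \<P> \<Q> \<longrightarrow> Dhp_stable (payoff W) (users W) \<Q>))"
proof -
  \<comment> \<open>Termination rests on the finiteness of the player set.\<close>
  have "finite (users W)"
    by (simp add: users_def)
  with assms(2) show ?thesis
    by (simp add: no_infinite_run final_partition_exists final_partition_Dhp_stable
        Dc_stable_final_partition_eq Dc_stable_optimal)
qed

end
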